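(* Let $X$ be a real Banach space with closed unit ball $B_X$. Then $X$ is a $K$-space if and only if every $\varepsilon$-affine function $f:B_X\to\mathbb{R}$ (for any $\varepsilon$) is uniformly approximable by an affine function, i.e. there exists an affine function $a:B_X\to\mathbb{R}$ with $\sup_{x\in B_X}|f(x)-a(x)|<\infty$.
   Context: A map $f:X\to\mathbb{R}$ on a real Banach space $X$ is quasi-linear if it is homogeneous ($f(tx)=tf(x)$ for all $x\in X$, $t\in\mathbb{R}$) and there is a constant $Q$ such that $|f(x+y)-f(x)-f(y)|\le Q(\|x\|+\|y\|)$ for all $x,y\in X$. A Banach space $X$ is a $K$-space if for every quasi-linear map $f:X\to\mathbb{R}$ there is a linear (not necessarily continuous) functional $\ell:X\to\mathbb{R}$ and a constant $M$ such that $|f(x)-\ell(x)|\le M\|x\|$ for all $x\in X$. For a convex set $D$, a function $f:D\to\mathbb{R}$ is $\varepsilon$-affine if $|f(tx+(1-t)y)-tf(x)-(1-t)f(y)|\le\varepsilon$ for all $x,y\in D$, $t\in[0,1]$; it is affine if this holds with $\varepsilon=0$. *)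

theory Defs
  imports "HOL-Analysis.Analysis"
begin

definition quasi_linear :: "('a::real_normed_vector \<Rightarrow> real) \<Rightarrow> bool" where
  "quasi_linear f \<longleftrightarrow>
     (\<forall>t x. f (t *\<^sub>R x) = t * f x) \<and>
     (\<exists>Q. \<forall>x y. \<bar>f (x + y) - f x - f y\<bar> \<le> Q * (norm x + norm y))"

text \<open>The predicate concerns the whole space, hence the type argument. The constant
  \<^const>\<open>linear\<close> does not include continuity.\<close>

definition K_space :: "'a::banach itself \<Rightarrow> bool" where
  "K_space _ \<longleftrightarrow>
     (\<forall>f :: 'a \<Rightarrow> real. quasi_linear f \<longrightarrow>
        (\<exists>l :: 'a \<Rightarrow> real. linear l \<and> (\<exists>M. \<forall>x. \<bar>f x - l x\<bar> \<le> M * norm x)))"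

text \<open>A function on a convex set \<open>D\<close> is represented by a total function of which only the values
  on \<open>D\<close> matter.\<close>

definition eps_affine_on :: "'a::real_vector set \<Rightarrow> real \<Rightarrow> ('a \<Rightarrow> real) \<Rightarrow> bool" where
  "eps_affine_on D \<epsilon> f \<longleftrightarrow>
     (\<forall>x\<in>D. \<forall>y\<in>D. \<forall>t\<in>{0..1}.
        \<bar>f (t *\<^sub>R x + (1 - t) *\<^sub>R y) - t * f x - (1 - t) * f y\<bar> \<le> \<epsilon>)"

definition affine_fun_on :: "'a::real_vector set \<Rightarrow> ('a \<Rightarrow> real) \<Rightarrow> bool" where
  "affine_fun_on D f \<longleftrightarrow> eps_affine_on D 0 f"

end

theory Submission imports Defs begin

text \<open>On the unit ball, a quasi-linear map is \<open>\<epsilon>\<close>-affine, and an affine function vanishing at \<open>0\<close>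
  is the restriction of a linear functional. Conversely, an \<open>\<epsilon>\<close>-affine function differs by a bounded
  amount from a constant plus its odd part \<open>g\<close>; the homogeneous map \<open>x \<mapsto> \<parallel>x\<parallel> g (x / \<parallel>x\<parallel>)\<close> is
  within \<open>\<epsilon>\<close> of \<open>g\<close> on the ball, and comparing it with \<open>g\<close> at midpoints of the ball shows that it is
  quasi-linear.\<close>

lemma eps_affine_onD:
  assumes "eps_affine_on D e f" "x \<in> D" "y \<in> D" "0 \<le> t" "t \<le> 1"
  shows "\<bar>f (t *\<^sub>R x + (1 - t) *\<^sub>R y) - t * f x - (1 - t) * f y\<bar> \<le> e"
  using assms by (auto simp: eps_affine_on_def)

lemma eps_affine_on_nonneg:
  assumes "eps_affine_on D e f" "x \<in> D"
  shows "0 \<le> e"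
  using eps_affine_onD[OF assms(1,2,2), of 0] by linarith

lemma eps_affine_on_midpoint:
  assumes "eps_affine_on D e f" "x \<in> D" "y \<in> D"
  shows "\<bar>f ((1/2) *\<^sub>R (x + y)) - (f x + f y) / 2\<bar> \<le> e"
  using eps_affine_onD[OF assms, of "1/2"] by (simp add: scaleR_right_distrib field_simps)

lemma affine_fun_onD:
  assumes "affine_fun_on D a" "x \<in> D" "y \<in> D" "0 \<le> t" "t \<le> 1"
  shows "a (t *\<^sub>R x + (1 - t) *\<^sub>R y) = t * a x + (1 - t) * a y"
  using eps_affine_onD[of D 0 a x y t] assms by (simp add: affine_fun_on_def)

lemma linear_plus_const_affine_fun_on:
  assumes "linear l"
  shows "affine_fun_on D (\<lambda>x. c + l x :: real)"
  using assms
  by (simp add: affine_fun_on_def eps_affine_on_def linear_add linear_scale) (simp add: algebra_simps)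

text \<open>Homogeneity turns \<open>t * f x\<close> into \<open>f (t *\<^sub>R x)\<close>, so the
  affine defect is the additivity defect at two vectors whose norms sum to at most 1. The absolute
  value of \<open>Q\<close> covers a negative constant.\<close>

lemma quasi_linear_imp_eps_affine_on_cball:
  fixes f :: "'a::real_normed_vector \<Rightarrow> real"
  assumes "quasi_linear f"
  shows "\<exists>e. eps_affine_on (cball 0 1) e f"
proof -
  obtain Q where Q: "\<And>x y. \<bar>f (x + y) - f x - f y\<bar> \<le> Q * (norm x + norm y)"
    and hom: "\<And>t x. f (t *\<^sub>R x) = t * f x"
    using assms by (auto simp: quasi_linear_def)
  have "\<bar>f (t *\<^sub>R x + (1 - t) *\<^sub>R y) - t * f x - (1 - t) * f y\<bar> \<le> \<bar>Q\<bar>"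
    if "norm x \<le> 1" "norm y \<le> 1" "0 \<le> t" "t \<le> 1" for x y t
  proof -
    have "norm (t *\<^sub>R x) + norm ((1 - t) *\<^sub>R y) \<le> t * 1 + (1 - t) * 1"
      unfolding norm_scaleR using that by (intro add_mono mult_mono) auto
    then have "Q * (norm (t *\<^sub>R x) + norm ((1 - t) *\<^sub>R y)) \<le> \<bar>Q\<bar> * 1"
      by (intro mult_mono) auto
    with Q[of "t *\<^sub>R x" "(1 - t) *\<^sub>R y"] show ?thesis
      by (simp add: hom)
  qed
  then have "eps_affine_on (cball 0 1) \<bar>Q\<bar> f"
    by (simp add: eps_affine_on_def)
  then show ?thesis ..
qed

text \<open>Since \<open>a 0 = 0\<close>, affinity along a radius lets \<open>a\<close> commute with
  shrinking. Hence \<open>r * a (x /\<^sub>R r)\<close> does not depend on the positive radius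
  \<open>r \<ge> norm x\<close>, and this common value is the extension.\<close>

lemma affine_fun_on_cball_extends_linear:
  fixes a :: "'a::real_normed_vector \<Rightarrow> real"
  assumes aff: "affine_fun_on (cball 0 1) a" and a0: "a 0 = 0"
  obtains l where "linear l" "\<And>x. norm x \<le> 1 \<Longrightarrow> l x = a x"
proof -
  have shrink: "a (t *\<^sub>R x) = t * a x" if "norm x \<le> 1" "0 \<le> t" "t \<le> 1" for x t
    using affine_fun_onD[OF aff, of x 0 t] that a0 by simp
  have rescale: "r * a (x /\<^sub>R r) = s * a (x /\<^sub>R s)" if "norm x \<le> r" "r \<le> s" "0 < r" for x r s
    using shrink[of "x /\<^sub>R r" "r / s"] that by (simp add: field_simps)
  \<comment> \<open>Any admissible radius would do; adding 1 keeps this one positive at the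
    origin.\<close>
  define l where "l x = (norm x + 1) * a (x /\<^sub>R (norm x + 1))" for x
  have l_eq: "l x = r * a (x /\<^sub>R r)" if "norm x \<le> r" "0 < r" for x r
  proof (cases "r \<le> norm x + 1")
    case True
    then show ?thesis
      using rescale[of x r "norm x + 1"] that by (simp add: l_def)
  next
    case False
    then show ?thesis
      using rescale[of x "norm x + 1" r] by (simp add: l_def add_nonneg_pos)
  qed
  have add: "l (x + y) = l x + l y" for x y
  proof -
    \<comment> \<open>Rescaling \<open>x\<close> and \<open>y\<close> by \<open>r\<close> and their
      sum by \<open>2 * r\<close> makes the image of the sum the midpoint of the other two, all
      inside the ball.\<close>
    define r where "r = norm x + norm y + 1"
    have r: "0 < r" "norm x \<le> r" "norm y \<le> r" "norm (x + y) \<le> 2 * r"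
      using norm_triangle_ineq[of x y] norm_ge_zero[of x] norm_ge_zero[of y]
      unfolding r_def distrib_left by linarith+
    have "l (x + y) = 2 * r * a ((x + y) /\<^sub>R (2 * r))"
      using r by (intro l_eq) auto
    also have "(x + y) /\<^sub>R (2 * r) = (1/2) *\<^sub>R (x /\<^sub>R r) + (1 - 1/2) *\<^sub>R (y /\<^sub>R r)"
      by (simp add: scaleR_right_distrib)
    also have "a \<dots> = 1/2 * a (x /\<^sub>R r) + (1 - 1/2) * a (y /\<^sub>R r)"
      using r by (intro affine_fun_onD[OF aff]) (auto simp: divide_simps)
    also have "2 * r * \<dots> = l x + l y"
      using r by (simp add: l_eq[of x r] l_eq[of y r] algebra_simps)
    finally show ?thesis .
  qed
  have l0: "l 0 = 0"
    using a0 by (simp add: l_def)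
  have pos: "l (c *\<^sub>R x) = c * l x" if "0 < c" for c x
  proof -
    have n: "0 < norm x + 1"
      by (simp add: add_nonneg_pos)
    \<comment> \<open>Scaling the radius together with the vector leaves the argument of
      \<open>a\<close> unchanged.\<close>
    have "l (c *\<^sub>R x) = (c * (norm x + 1)) * a ((c *\<^sub>R x) /\<^sub>R (c * (norm x + 1)))"
      using that n by (intro l_eq) auto
    also have "(c *\<^sub>R x) /\<^sub>R (c * (norm x + 1)) = x /\<^sub>R (norm x + 1)"
      using that by simp
    finally show ?thesis
      by (simp add: l_def)
  qed
  have neg: "l (- x) = - l x" for x
    using add[of x "- x"] l0 by simp
  have "l (c *\<^sub>R x) = c * l x" for c x
    using pos[of c x] pos[of "- c" x] neg[of "c *\<^sub>R x"] l0 by (cases c "0::real" rule: linorder_cases) auto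
  then have "linear l"
    using add by (intro linearI) auto
  moreover have "l x = a x" if "norm x \<le> 1" for x
    using l_eq[of x 1] that by simp
  ultimately show ?thesis
    using that by blast
qed

text \<open>The ball is symmetric, so reflecting and negating \<open>f\<close> keeps the constant
  \<open>e\<close>, and averaging the result with \<open>f\<close> does too.\<close>

lemma eps_affine_on_odd_part:
  fixes f :: "'a::real_normed_vector \<Rightarrow> real"
  assumes f: "eps_affine_on (cball 0 1) e f"
  shows "eps_affine_on (cball 0 1) e (\<lambda>x. (f x - f (- x)) / 2)"
  unfolding eps_affine_on_def
proof (intro ballI)
  fix x y :: 'a and t :: real
  assume *: "x \<in> cball 0 1" "y \<in> cball 0 1" "t \<in> {0..1}"
  have "- (t *\<^sub>R x + (1 - t) *\<^sub>R y) = t *\<^sub>R (- x) + (1 - t) *\<^sub>R (- y)"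
    by simp
  then have "\<bar>f (- (t *\<^sub>R x + (1 - t) *\<^sub>R y)) - t * f (- x) - (1 - t) * f (- y)\<bar> \<le> e"
    using eps_affine_onD[OF f, of "- x" "- y" t] * by auto
  moreover have "\<bar>f (t *\<^sub>R x + (1 - t) *\<^sub>R y) - t * f x - (1 - t) * f y\<bar> \<le> e"
    using eps_affine_onD[OF f, of x y t] * by auto
  ultimately show "\<bar>(f (t *\<^sub>R x + (1 - t) *\<^sub>R y) - f (- (t *\<^sub>R x + (1 - t) *\<^sub>R y))) / 2
      - t * ((f x - f (- x)) / 2) - (1 - t) * ((f y - f (- y)) / 2)\<bar> \<le> e"
    by (simp add: field_simps abs_le_iff)
qed

lemma odd_eps_affine_near_quasi_linear:
  fixes g :: "'a::real_normed_vector \<Rightarrow> real"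
  assumes g: "eps_affine_on (cball 0 1) e g" and odd: "\<And>x. g (- x) = - g x"
  obtains F where "quasi_linear F" "\<And>x. norm x \<le> 1 \<Longrightarrow> \<bar>F x - g x\<bar> \<le> e"
proof -
  \<comment> \<open>This is the radial extension of \<open>g\<close> from the unit sphere. At the
    origin the factor \<open>norm x\<close> gives 0, whatever the value of \<open>g\<close>.\<close>
  define F where "F x = norm x * g (x /\<^sub>R norm x)" for x
  have g0: "g 0 = 0"
    using odd[of 0] by simp
  have hom: "F (t *\<^sub>R x) = t * F x" for t x
  proof (cases t "0::real" rule: linorder_cases)
    case less
    then have "(t *\<^sub>R x) /\<^sub>R norm (t *\<^sub>R x) = - (x /\<^sub>R norm x)"
      by simp
    with odd have "g ((t *\<^sub>R x) /\<^sub>R norm (t *\<^sub>R x)) = - g (x /\<^sub>R norm x)"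
      by metis
    with less show ?thesis
      unfolding F_def by simp
  next
    case greater
    then have "(t *\<^sub>R x) /\<^sub>R norm (t *\<^sub>R x) = x /\<^sub>R norm x"
      by simp
    then have "F (t *\<^sub>R x) = norm (t *\<^sub>R x) * g (x /\<^sub>R norm x)"
      by (simp only: F_def)
    with greater show ?thesis
      by (simp add: F_def)
  qed (simp add: F_def)
  have near: "\<bar>F x - g x\<bar> \<le> e" if "norm x \<le> 1" for x
  proof (cases "x = 0")
    case True
    then show ?thesis
      using eps_affine_on_nonneg[OF g, of 0] g0 by (simp add: F_def)
  next
    case False
    then show ?thesis
      \<comment> \<open>Here \<open>x\<close> is the combination of its normalization and 0 with
        weight \<open>norm x\<close>, so the affine defect is exactly the difference of
        \<open>g x\<close> and \<open>F x\<close>.\<close>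
      using eps_affine_onD[OF g, of "x /\<^sub>R norm x" 0 "norm x"] that g0
      by (simp add: F_def abs_minus_commute)
  qed
  \<comment> \<open>The sum is twice a midpoint. Passing from \<open>F\<close> to \<open>g\<close>
    there costs \<open>2 * e\<close>, splitting \<open>g\<close> at the midpoint another
    \<open>2 * e\<close>, and returning to \<open>F\<close> at \<open>x\<close> and \<open>y\<close>
    costs \<open>e\<close> each.\<close>
  have unit: "\<bar>F (x + y) - F x - F y\<bar> \<le> 6 * e" if "norm x + norm y \<le> 1" for x y
  proof -
    have n: "norm x \<le> 1" "norm y \<le> 1" "norm ((1/2) *\<^sub>R (x + y)) \<le> 1"
      using that norm_triangle_ineq[of x y] norm_ge_zero[of x] norm_ge_zero[of y]
      unfolding norm_scaleR by linarith+
    have "F ((1/2) *\<^sub>R (x + y)) = F (x + y) / 2"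
      by (simp only: hom)
    then show ?thesis
      using near[OF n(1)] near[OF n(2)] near[OF n(3)] eps_affine_on_midpoint[OF g, of x y] n
      by (simp add: abs_le_iff field_simps)
  qed
  have "\<bar>F (x + y) - F x - F y\<bar> \<le> 6 * e * (norm x + norm y)" for x y
  proof (cases "norm x + norm y = 0")
    case True
    then have "x = 0" "y = 0"
      using norm_ge_zero[of x] norm_ge_zero[of y] by (simp_all add: add_nonneg_eq_0_iff)
    then show ?thesis
      by (simp add: F_def)
  next
    case False
    \<comment> \<open>Dividing by \<open>s\<close> brings the pair into the range of
      \<open>unit\<close>; homogeneity carries the bound back with the factor
      \<open>s\<close>.\<close>
    define s where "s = norm x + norm y"
    have s: "0 < s"
      using False by (simp add: s_def less_le)
    have "norm (x /\<^sub>R s) + norm (y /\<^sub>R s) \<le> 1"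
      using s by (simp add: s_def field_simps)
    from unit[OF this] have "\<bar>F ((x + y) /\<^sub>R s) - F (x /\<^sub>R s) - F (y /\<^sub>R s)\<bar> \<le> 6 * e"
      by (simp add: scaleR_right_distrib)
    then have "\<bar>(F (x + y) - F x - F y) / s\<bar> \<le> 6 * e"
      by (simp only: hom) (simp add: divide_inverse algebra_simps)
    then show ?thesis
      using s by (simp add: abs_divide pos_divide_le_eq flip: s_def)
  qed
  then have "quasi_linear F"
    using hom by (auto simp: quasi_linear_def)
  then show ?thesis
    using near that by blast
qed

theorem theorem1:
  shows "K_space TYPE('a::banach) \<longleftrightarrow>
    (\<forall>(\<epsilon>::real) (f :: 'a \<Rightarrow> real). eps_affine_on (cball 0 1) \<epsilon> f \<longrightarrow>
       (\<exists>a :: 'a \<Rightarrow> real. affine_fun_on (cball 0 1) a \<and>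
          bdd_above ((\<lambda>x. \<bar>f x - a x\<bar>) ` cball 0 1)))"
proof (intro iffI allI impI)
  fix e and f :: "'a \<Rightarrow> real"
  assume K: "K_space TYPE('a)" and f: "eps_affine_on (cball 0 1) e f"
  obtain F where F: "quasi_linear F"
      "\<And>x. norm x \<le> 1 \<Longrightarrow> \<bar>F x - (f x - f (- x)) / 2\<bar> \<le> e"
    using odd_eps_affine_near_quasi_linear[OF eps_affine_on_odd_part[OF f]]
    by (metis minus_diff_eq minus_divide_left minus_minus)
  obtain l M where l: "linear l" and M: "\<And>x. \<bar>F x - l x\<bar> \<le> M * norm x"
    using K F(1) unfolding K_space_def by blast
  \<comment> \<open>The error splits into even part minus \<open>f 0\<close>, odd part minus
    \<open>F\<close>, and \<open>F\<close> minus \<open>l\<close>. The first is at most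
    \<open>e\<close> because 0 is the midpoint of \<open>x\<close> and \<open>- x\<close>; the
    others are at most \<open>e\<close> and \<open>\<bar>M\<bar>\<close>.\<close>
  have "\<bar>f x - (f 0 + l x)\<bar> \<le> 2 * e + \<bar>M\<bar>" if "norm x \<le> 1" for x
  proof -
    have "M * norm x \<le> \<bar>M\<bar> * 1"
      using that by (intro mult_mono) auto
    moreover have "\<bar>f 0 - (f x + f (- x)) / 2\<bar> \<le> e"
      using eps_affine_on_midpoint[OF f, of x "- x"] that by simp
    ultimately show ?thesis
      using M[of x] F(2)[OF that] by (simp add: abs_le_iff field_simps)
  qed
  then have "bdd_above ((\<lambda>x. \<bar>f x - (f 0 + l x)\<bar>) ` cball 0 1)"
    by (intro bdd_aboveI2) auto
  with linear_plus_const_affine_fun_on[OF l]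
  show "\<exists>a. affine_fun_on (cball 0 1) a \<and> bdd_above ((\<lambda>x. \<bar>f x - a x\<bar>) ` cball 0 1)"
    by blast
next
  assume A: "\<forall>(\<epsilon>::real) (f :: 'a \<Rightarrow> real). eps_affine_on (cball 0 1) \<epsilon> f \<longrightarrow>
       (\<exists>a. affine_fun_on (cball 0 1) a \<and> bdd_above ((\<lambda>x. \<bar>f x - a x\<bar>) ` cball 0 1))"
  show "K_space TYPE('a)"
    unfolding K_space_def
  proof (intro allI impI)
    fix f :: "'a \<Rightarrow> real"
    assume f: "quasi_linear f"
    then have hom: "f (t *\<^sub>R x) = t * f x" for t x
      by (simp add: quasi_linear_def)
    obtain a C where a: "affine_fun_on (cball 0 1) a"
      and C: "\<And>x. norm x \<le> 1 \<Longrightarrow> \<bar>f x - a x\<bar> \<le> C"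
      using A quasi_linear_imp_eps_affine_on_cball[OF f] by (fastforce simp: bdd_above_def)
    \<comment> \<open>Normalizing to vanish at 0 permits the linear extension and costs
      \<open>\<bar>a 0\<bar>\<close> in the bound.\<close>
    have "affine_fun_on (cball 0 1) (\<lambda>x. a x - a 0)"
      using a by (simp add: affine_fun_on_def eps_affine_on_def algebra_simps)
    then obtain l where l: "linear l" and la: "\<And>x. norm x \<le> 1 \<Longrightarrow> l x = a x - a 0"
      using affine_fun_on_cball_extends_linear[of "\<lambda>x. a x - a 0"] by auto
    \<comment> \<open>Both maps are homogeneous, so the uniform bound on the unit sphere becomes one
      proportional to the norm.\<close>
    have "\<bar>f x - l x\<bar> \<le> (C + \<bar>a 0\<bar>) * norm x" for x
    proof (cases "x = 0")
      case True
      then show ?thesis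
        using hom[of 0 0] linear_0[OF l] by simp
    next
      case False
      then have n: "norm (x /\<^sub>R norm x) \<le> 1"
        by simp
      have "\<bar>f (x /\<^sub>R norm x) - l (x /\<^sub>R norm x)\<bar> \<le> C + \<bar>a 0\<bar>"
        using C[OF n] la[OF n] by linarith
      then have "\<bar>(f x - l x) / norm x\<bar> \<le> C + \<bar>a 0\<bar>"
        by (simp add: hom linear_scale[OF l] divide_inverse algebra_simps)
      then show ?thesis
        using False by (simp add: abs_divide pos_divide_le_eq)
    qed
    with l show "\<exists>l. linear l \<and> (\<exists>M. \<forall>x. \<bar>f x - l x\<bar> \<le> M * norm x)"
      by blast
  qed
qed

end
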